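(* Let $ABCD$ be a quadrangle in the Euclidean plane whose diagonals are not parallel. The sides of a homothetic parallelogram of $ABCD$ (with any ratio $\lambda\in\mathbb{R}$) are parallel to the diagonals of the quadrangle $ABCD$. Also, the homothetic parallelograms of $ABCD$ are similar to each other.
   Context: $ABCD$ is an arbitrary quadrangle with vertices $A,B,C,D$ in this cyclic order, sides $AB,BC,CD,DA$ and diagonals $AC$ and $BD$; it may be convex, re-entrant (non-convex and not self-intersecting) or crossed (self-intersecting). For points $X,Y$ and $\lambda\in\mathbb{R}$, $X_Y^{\lambda}$ denotes the image of $Y$ under the homothety with center $X$ and ratio $\lambda$, i.e. $X_Y^{\lambda}=X+\lambda(Y-X)$. For $\lambda\in\mathbb{R}$, the homothetic parallelogram of $ABCD$ with ratio $\lambda$ is the parallelogram formed by the four lines $A_D^{\lambda}A_B^{\lambda}$, $B_A^{\lambda}B_C^{\lambda}$, $C_B^{\lambda}C_D^{\lambda}$, $D_C^{\lambda}D_A^{\lambda}$. For $\lambda=0$ it is understood as a limiting parallelogram: the four lines are replaced by their limits as $\lambda\to0$, namely the lines through $A$ and through $C$ parallel to $BD$, and the lines through $B$ and through $D$ parallel to $AC$. For $\lambda=1$ the homothetic parallelogram is the single point of intersection of the diagonals, and it is counted formally as a (degenerate) homothetic parallelogram.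
   Formalization: Similarity is stated only for homothetic parallelograms with ratios different from 1; for ratio 1 the parallelogram is the single intersection point of the diagonals, which is not similar to a proper parallelogram, and it is shown to be exactly that point. *)

theory Defs
  imports "HOL-Analysis.Analysis"
begin

type_synonym point = "real ^ 2"

abbreviation line :: "point \<Rightarrow> point \<Rightarrow> point set" where
  "line X Y \<equiv> affine hull {X, Y}"

definition homothety :: "point \<Rightarrow> real \<Rightarrow> point \<Rightarrow> point" where
  "homothety X r Y = X + r *\<^sub>R (Y - X)"

text \<open>For nonzero ratio, this is the line joining the images of \<open>Y\<close> and \<open>Z\<close> under the homothety with
  centre \<open>X\<close>. For ratio zero the two images coincide with \<open>X\<close>, and the limiting line, which is the
  parallel to \<open>YZ\<close> through \<open>X\<close>, is taken instead.\<close>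

definition homothetic_line :: "real \<Rightarrow> point \<Rightarrow> point \<Rightarrow> point \<Rightarrow> point set" where
  "homothetic_line r X Y Z =
     (if r = 0 then line X (X + (Z - Y)) else line (homothety X r Y) (homothety X r Z))"

text \<open>Opposite lines are parallel (possibly equal), and consecutive lines meet in exactly one point;
  the vertices \<open>P, Q, R, S\<close> lie on \<open>a, b\<close>, on \<open>b, c\<close>, on \<open>c, d\<close> and on \<open>d, a\<close>, so that the
  sides \<open>SP, PQ, QR, RS\<close> are carried by \<open>a, b, c, d\<close>. Degenerate parallelograms are allowed.\<close>

definition forms_parallelogram ::
  "point set \<Rightarrow> point set \<Rightarrow> point set \<Rightarrow> point set \<Rightarrow> point \<Rightarrow> point \<Rightarrow> point \<Rightarrow> point \<Rightarrow> bool" where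
  "forms_parallelogram a b c d P Q R S \<longleftrightarrow>
     affine_parallel a c \<and> affine_parallel b d \<and>
     a \<inter> b = {P} \<and> b \<inter> c = {Q} \<and> c \<inter> d = {R} \<and> d \<inter> a = {S}"

definition homothetic_parallelogram ::
  "point \<Rightarrow> point \<Rightarrow> point \<Rightarrow> point \<Rightarrow> real \<Rightarrow> point \<Rightarrow> point \<Rightarrow> point \<Rightarrow> point \<Rightarrow> bool" where
  "homothetic_parallelogram A B C D r P Q R S \<longleftrightarrow>
     forms_parallelogram
       (homothetic_line r A D B) (homothetic_line r B A C)
       (homothetic_line r C B D) (homothetic_line r D C A) P Q R S"

definition similarity :: "(point \<Rightarrow> point) \<Rightarrow> bool" where
  "similarity f \<longleftrightarrow> (\<exists>k>0. \<forall>x y. dist (f x) (f y) = k * dist x y)"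

text \<open>Polygons are given by their lists of vertices, and corresponding vertices must be mapped to
  each other.\<close>

definition similar_polygons :: "point list \<Rightarrow> point list \<Rightarrow> bool" where
  "similar_polygons Ps Qs \<longleftrightarrow> (\<exists>f. similarity f \<and> map f Ps = Qs)"

end

theory Submission
  imports Defs
begin

text \<open>Put the origin at the intersection \<open>M\<close> of the diagonals, so that the vertices are
  \<open>M + a u\<close>, \<open>M + b v\<close>, \<open>M + c u\<close>, \<open>M + d v\<close> with \<open>u\<close>, \<open>v\<close> independent. For every ratio
  \<open>r\<close>, including \<open>0\<close>, the homothetic line at a vertex \<open>X\<close> is then the parallel to the opposite
  diagonal through \<open>M + (1 - r) (X - M)\<close>. Hence the homothetic parallelogram of ratio \<open>r\<close> is the
  image of the one of ratio \<open>0\<close> under the homothety with centre \<open>M\<close> and ratio \<open>1 - r\<close>.\<close>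

section \<open>Lines given by a point and a direction\<close>

text \<open>With a direction in place of a second point, parallelism is visible at once and the
  limiting lines of ratio \<open>0\<close> have the same shape as the others.\<close>

definition line_along :: "'a \<Rightarrow> 'a \<Rightarrow> 'a::real_vector set" where
  "line_along X w = range (\<lambda>t. X + t *\<^sub>R w)"

text \<open>Phrased by coefficients, because \<open>independent {u, v}\<close> would also admit
  \<open>u = v\<close> with \<open>u\<close> nonzero.\<close>

definition independent_pair :: "'a::real_vector \<Rightarrow> 'a \<Rightarrow> bool" where
  "independent_pair u v \<longleftrightarrow> (\<forall>p q. p *\<^sub>R u + q *\<^sub>R v = 0 \<longrightarrow> p = 0 \<and> q = 0)"

lemma independent_pairD:
  assumes "independent_pair u v" "p *\<^sub>R u + q *\<^sub>R v = 0"
  shows "p = 0" "q = 0"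
  using assms unfolding independent_pair_def by blast+

lemma line_along_iff: "x \<in> line_along X w \<longleftrightarrow> (\<exists>t. x = X + t *\<^sub>R w)"
  by (auto simp: line_along_def)

lemma affine_hull_pair_eq_line_along: "affine hull {X, Y} = line_along X (Y - X)"
  by (simp add: affine_hull_2_alt line_along_def)

lemma line_along_shift: "line_along (X + c *\<^sub>R w) w = line_along X w"
proof (intro set_eqI iffI)
  fix x assume "x \<in> line_along (X + c *\<^sub>R w) w"
  then obtain t where "x = X + (c + t) *\<^sub>R w"
    by (auto simp: line_along_iff algebra_simps)
  then show "x \<in> line_along X w"
    by (auto simp: line_along_iff)
next
  fix x assume "x \<in> line_along X w"
  then obtain t where "x = X + t *\<^sub>R w"
    by (auto simp: line_along_iff)
  then have "x = X + c *\<^sub>R w + (t - c) *\<^sub>R w"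
    by (simp add: algebra_simps)
  then show "x \<in> line_along (X + c *\<^sub>R w) w"
    unfolding line_along_iff by blast
qed

lemma line_along_scale:
  assumes "k \<noteq> 0"
  shows "line_along X (k *\<^sub>R w) = line_along X w"
proof (intro set_eqI iffI)
  fix x assume "x \<in> line_along X (k *\<^sub>R w)"
  then show "x \<in> line_along X w"
    by (auto simp: line_along_iff)
next
  fix x assume "x \<in> line_along X w"
  then obtain t where "x = X + t *\<^sub>R w"
    by (auto simp: line_along_iff)
  then have "x = X + (t / k) *\<^sub>R (k *\<^sub>R w)"
    using assms by simp
  then show "x \<in> line_along X (k *\<^sub>R w)"
    unfolding line_along_iff by blast
qed

lemma affine_parallel_line_along: "affine_parallel (line_along X w) (line_along Y w)"
proof -
  have "line_along Y w = (\<lambda>x. (Y - X) + x) ` line_along X w"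
    unfolding line_along_def image_image by simp
  then show ?thesis
    unfolding affine_parallel_def by blast
qed

lemma affine_hull_pair_eq_line_along':
  assumes "Y = X + k *\<^sub>R w" "k \<noteq> 0"
  shows "affine hull {X, Y} = line_along X w"
  by (simp add: affine_hull_pair_eq_line_along assms line_along_scale)

lemma line_along_Int:
  assumes indep: "independent_pair u v"
  shows "line_along (M + a *\<^sub>R u) v \<inter> line_along (M + b *\<^sub>R v) u = {M + a *\<^sub>R u + b *\<^sub>R v}"
proof (intro set_eqI iffI)
  fix x assume "x \<in> line_along (M + a *\<^sub>R u) v \<inter> line_along (M + b *\<^sub>R v) u"
  then obtain s t where s: "x = M + a *\<^sub>R u + s *\<^sub>R v" and t: "x = M + b *\<^sub>R v + t *\<^sub>R u"
    unfolding Int_iff line_along_iff by blast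
  then have "M + a *\<^sub>R u + s *\<^sub>R v = M + b *\<^sub>R v + t *\<^sub>R u"
    by simp
  \<comment> \<open>Comparing coefficients gives \<open>s = b\<close>, which fixes the common
    point.\<close>
  then have "(a - t) *\<^sub>R u + (s - b) *\<^sub>R v = 0"
    by (simp add: algebra_simps)
  from independent_pairD[OF indep this] s show "x \<in> {M + a *\<^sub>R u + b *\<^sub>R v}"
    by simp
next
  fix x assume x: "x \<in> {M + a *\<^sub>R u + b *\<^sub>R v}"
  then have "x = M + b *\<^sub>R v + a *\<^sub>R u"
    by (simp add: algebra_simps)
  with x show "x \<in> line_along (M + a *\<^sub>R u) v \<inter> line_along (M + b *\<^sub>R v) u"
    by (auto simp: line_along_iff)
qed

section \<open>Homothetic lines and homotheties\<close>

text \<open>The images of \<open>Y\<close> and \<open>Z\<close> differ by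
  \<open>(r * (z - y)) *\<^sub>R w\<close>, so the line has direction \<open>w\<close>. The image of
  \<open>Y\<close> is \<open>M + (1 - r) *\<^sub>R (X - M)\<close> moved by
  \<open>(r * y) *\<^sub>R w\<close>, a shift along the line itself.\<close>

lemma homothetic_line_eq_line_along:
  assumes Y: "Y = M + y *\<^sub>R w" and Z: "Z = M + z *\<^sub>R w" and "y \<noteq> z"
  shows "homothetic_line r X Y Z = line_along (M + (1 - r) *\<^sub>R (X - M)) w"
proof (cases "r = 0")
  case True
  have "line X (X + (Z - Y)) = line_along X w"
    by (rule affine_hull_pair_eq_line_along'[where k = "z - y"])
      (use assms in \<open>auto simp: algebra_simps\<close>)
  with True show ?thesis
    by (simp add: homothetic_line_def)
next
  case False
  let ?X = "M + (1 - r) *\<^sub>R (X - M)"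
  have "homothety X r Z = homothety X r Y + (r * (z - y)) *\<^sub>R w"
    by (simp add: homothety_def Y Z algebra_simps)
  then have "homothetic_line r X Y Z = line_along (homothety X r Y) w"
    unfolding homothetic_line_def
    using False \<open>y \<noteq> z\<close> by (simp add: affine_hull_pair_eq_line_along'[where k = "r * (z - y)"])
  also have "homothety X r Y = ?X + (r * y) *\<^sub>R w"
    by (simp add: homothety_def Y algebra_simps)
  also have "line_along \<dots> w = line_along ?X w"
    by (rule line_along_shift)
  finally show ?thesis .
qed

lemma similarity_homothety:
  assumes "k \<noteq> 0"
  shows "similarity (homothety X k)"
proof -
  \<comment> \<open>The absolute value matters: the ratio \<open>1 - r\<close> is negative for
    \<open>r > 1\<close>.\<close>
  have "dist (homothety X k x) (homothety X k y) = \<bar>k\<bar> * dist x y" for x y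
  proof -
    have "homothety X k x - homothety X k y = k *\<^sub>R (x - y)"
      by (simp add: homothety_def algebra_simps)
    then show ?thesis
      by (simp add: dist_norm)
  qed
  with assms show ?thesis
    unfolding similarity_def by (intro exI[of _ "\<bar>k\<bar>"]) auto
qed

text \<open>The homothety with the same centre and ratio \<open>l / k\<close> carries the first
  image to the second, vertex by vertex.\<close>

lemma similar_polygons_homothety:
  assumes "k \<noteq> 0" "l \<noteq> 0"
  shows "similar_polygons (map (homothety X k) Ps) (map (homothety X l) Ps)"
proof -
  have "homothety X (l / k) (homothety X k x) = homothety X l x" for x
    using assms by (simp add: homothety_def)
  moreover have "similarity (homothety X (l / k))"
    using assms by (intro similarity_homothety) simp
  ultimately show ?thesis
    unfolding similar_polygons_def by (intro exI[of _ "homothety X (l / k)"]) simp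
qed

section \<open>Coordinates along the diagonals\<close>

lemma independent_pair_spans_plane:
  fixes u v w :: point
  assumes indep: "independent_pair u v"
  obtains p q where "w = p *\<^sub>R u + q *\<^sub>R v"
proof -
  have "u \<noteq> v"
    using independent_pairD[OF indep, of 1 "-1"] by auto
  have "v \<noteq> 0"
    using independent_pairD[OF indep, of 0 1] by auto
  have "u \<notin> span {v}"
  proof
    assume "u \<in> span {v}"
    then obtain k where "u = k *\<^sub>R v"
      by (auto simp: span_singleton)
    with independent_pairD[OF indep, of 1 "-k"] show False
      by simp
  qed
  with \<open>v \<noteq> 0\<close> have "independent {u, v}"
    by (simp add: independent_insert)
  \<comment> \<open>Two distinct independent vectors are as many as the dimension of the
    plane.\<close>
  then have "UNIV \<subseteq> span {u, v}"
    by (rule card_ge_dim_independent[rotated]) (use \<open>u \<noteq> v\<close> in auto)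
  then have "w \<in> span {u, v}"
    by blast
  then obtain p where "w - p *\<^sub>R u \<in> span {v}"
    using span_breakdown_eq by blast
  then obtain q where "w - p *\<^sub>R u = q *\<^sub>R v"
    by (auto simp: span_singleton)
  then have "w = p *\<^sub>R u + q *\<^sub>R v"
    by (simp add: algebra_simps)
  then show thesis
    by (rule that)
qed

text \<open>No signs are imposed on the parameters, so convex, re-entrant and crossed quadrangles
  are covered alike.\<close>

lemma diagonal_coordinates:
  fixes A B C D :: point
  assumes "A \<noteq> C" "B \<noteq> D" and nonpar: "\<not> affine_parallel (line A C) (line B D)"
  obtains M u v a b c d where
    "independent_pair u v"
    "A = M + a *\<^sub>R u" "B = M + b *\<^sub>R v" "C = M + c *\<^sub>R u" "D = M + d *\<^sub>R v"
    "a \<noteq> c" "b \<noteq> d"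
proof -
  define u v where "u = C - A" and "v = D - B"
  have "u \<noteq> 0" "v \<noteq> 0"
    using assms by (auto simp: u_def v_def)
  have indep: "independent_pair u v"
    unfolding independent_pair_def
  proof (intro allI impI, rule ccontr)
    fix p q
    assume that: "p *\<^sub>R u + q *\<^sub>R v = 0" and "\<not> (p = 0 \<and> q = 0)"
    \<comment> \<open>As \<open>u\<close> and \<open>v\<close> are nonzero, a nontrivial relation
      involves both, so the diagonals would share a direction.\<close>
    with that \<open>u \<noteq> 0\<close> \<open>v \<noteq> 0\<close> have "p \<noteq> 0" "q \<noteq> 0"
      by auto
    have "p *\<^sub>R u = (- q) *\<^sub>R v"
      using that by (simp add: add_eq_0_iff2)
    then have "line_along A u = line_along A v"
      using \<open>p \<noteq> 0\<close> \<open>q \<noteq> 0\<close> by (metis line_along_scale neg_equal_0_iff_equal)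
    then have "affine_parallel (line A C) (line B D)"
      by (simp add: affine_hull_pair_eq_line_along affine_parallel_line_along flip: u_def v_def)
    with nonpar show False ..
  qed
  obtain p q where pq: "B - A = p *\<^sub>R u + q *\<^sub>R v"
    using independent_pair_spans_plane[OF indep] .
  \<comment> \<open>This point lies on \<open>AC\<close>, and it equals
    \<open>B - q *\<^sub>R v\<close>, so it lies on \<open>BD\<close> too. Since
    \<open>C = A + u\<close> and \<open>D = B + v\<close>, the parameters of \<open>C\<close> and
    \<open>D\<close> exceed those of \<open>A\<close> and \<open>B\<close> by 1.\<close>
  let ?M = "A + p *\<^sub>R u"
  show thesis
  proof (rule that[of u v ?M "- p" q "1 - p" "1 + q"])
    show B: "B = ?M + q *\<^sub>R v"
      using pq by (simp add: algebra_simps)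
    have "D = B + v"
      by (simp add: v_def)
    then show "D = ?M + (1 + q) *\<^sub>R v"
      using B by (simp add: algebra_simps)
    show "C = ?M + (1 - p) *\<^sub>R u"
      by (simp add: u_def algebra_simps)
  qed (use indep in auto)
qed

section \<open>The homothetic parallelogram in diagonal coordinates\<close>

context
  fixes A B C D M u v :: point and a b c d :: real
  assumes indep: "independent_pair u v"
    and A: "A = M + a *\<^sub>R u" and B: "B = M + b *\<^sub>R v"
    and C: "C = M + c *\<^sub>R u" and D: "D = M + d *\<^sub>R v"
    and "a \<noteq> c" and "b \<noteq> d"
begin

lemma homothetic_lines_eq:
  "homothetic_line r A D B = line_along (M + ((1 - r) * a) *\<^sub>R u) v"
  "homothetic_line r B A C = line_along (M + ((1 - r) * b) *\<^sub>R v) u"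
  "homothetic_line r C B D = line_along (M + ((1 - r) * c) *\<^sub>R u) v"
  "homothetic_line r D C A = line_along (M + ((1 - r) * d) *\<^sub>R v) u"
  using homothetic_line_eq_line_along[OF D B] homothetic_line_eq_line_along[OF A C]
    homothetic_line_eq_line_along[OF B D] homothetic_line_eq_line_along[OF C A]
    \<open>a \<noteq> c\<close> \<open>b \<noteq> d\<close>
  by (simp_all add: A B C D)

lemma diagonals_eq: "line A C = line_along M u" "line B D = line_along M v"
proof -
  have "line A C = line_along A u"
    by (rule affine_hull_pair_eq_line_along'[where k = "c - a"])
      (use \<open>a \<noteq> c\<close> in \<open>auto simp: A C algebra_simps\<close>)
  then show "line A C = line_along M u"
    by (simp add: A line_along_shift)
  have "line B D = line_along B v"
    by (rule affine_hull_pair_eq_line_along'[where k = "d - b"])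
      (use \<open>b \<noteq> d\<close> in \<open>auto simp: B D algebra_simps\<close>)
  then show "line B D = line_along M v"
    by (simp add: B line_along_shift)
qed

text \<open>The four lines alternate between the directions \<open>v\<close> and \<open>u\<close>,
  so opposite ones are parallel and consecutive ones meet in a single point, which determines the
  vertices. The list on the right is the parallelogram of ratio \<open>0\<close>; at
  \<open>r = 1\<close> it collapses to \<open>M\<close>.\<close>

lemma homothetic_parallelogram_iff:
  "homothetic_parallelogram A B C D r P Q R S \<longleftrightarrow>
    [P, Q, R, S] = map (homothety M (1 - r))
      [M + a *\<^sub>R u + b *\<^sub>R v, M + c *\<^sub>R u + b *\<^sub>R v,
       M + c *\<^sub>R u + d *\<^sub>R v, M + a *\<^sub>R u + d *\<^sub>R v]"
proof -
  have vertex: "homothety M (1 - r) (M + p *\<^sub>R u + q *\<^sub>R v) =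
      M + ((1 - r) * p) *\<^sub>R u + ((1 - r) * q) *\<^sub>R v" for p q
    by (simp add: homothety_def algebra_simps)
  note int = line_along_Int[OF indep]
  \<comment> \<open>Needed for the vertices \<open>P\<close>, \<open>Q\<close>, \<open>R\<close>,
    \<open>S\<close> in cyclic order: at \<open>Q\<close> and \<open>S\<close> the line along
    \<open>u\<close> comes first.\<close>
  have int': "line_along (M + q *\<^sub>R v) u \<inter> line_along (M + p *\<^sub>R u) v = {M + p *\<^sub>R u + q *\<^sub>R v}" for p q
    using int by (simp add: Int_commute)
  show ?thesis
    unfolding homothetic_parallelogram_def forms_parallelogram_def homothetic_lines_eq
    by (simp only: int int' vertex list.map affine_parallel_line_along) auto
qed

end

theorem corollary1:
  fixes A B C D :: point
  assumes "distinct [A, B, C, D]"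
    and "\<not> affine_parallel (line A C) (line B D)"
  shows
    "(\<forall>r. \<exists>P Q R S. homothetic_parallelogram A B C D r P Q R S) \<and>
     (\<forall>r. affine_parallel (homothetic_line r A D B) (line B D) \<and>
             affine_parallel (homothetic_line r B A C) (line A C) \<and>
             affine_parallel (homothetic_line r C B D) (line B D) \<and>
             affine_parallel (homothetic_line r D C A) (line A C)) \<and>
     (\<forall>r P Q R S. r \<noteq> 1 \<and> homothetic_parallelogram A B C D r P Q R S \<longrightarrow>
             affine_parallel (line S P) (line B D) \<and> affine_parallel (line P Q) (line A C) \<and>
             affine_parallel (line Q R) (line B D) \<and> affine_parallel (line R S) (line A C)) \<and>
     (\<forall>P Q R S. homothetic_parallelogram A B C D 1 P Q R S \<longrightarrow>
             line A C \<inter> line B D = {P} \<and> Q = P \<and> R = P \<and> S = P) \<and>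
     (\<forall>r r' P Q R S P' Q' R' S'. r \<noteq> 1 \<and> r' \<noteq> 1 \<and>
             homothetic_parallelogram A B C D r P Q R S \<and>
             homothetic_parallelogram A B C D r' P' Q' R' S' \<longrightarrow>
             similar_polygons [P, Q, R, S] [P', Q', R', S'])"
proof -
  have "A \<noteq> C" "B \<noteq> D"
    using assms(1) by auto
  obtain M u v a b c d where coords:
    "independent_pair u v"
    "A = M + a *\<^sub>R u" "B = M + b *\<^sub>R v" "C = M + c *\<^sub>R u" "D = M + d *\<^sub>R v"
    "a \<noteq> c" "b \<noteq> d"
    by (rule diagonal_coordinates[OF \<open>A \<noteq> C\<close> \<open>B \<noteq> D\<close> assms(2)]) blast
  note lines = homothetic_lines_eq[OF coords] diagonals_eq[OF coords]
  note parallelogram = homothetic_parallelogram_iff[OF coords]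
  have sides: "affine_parallel (line S P) (line B D)" "affine_parallel (line P Q) (line A C)"
    "affine_parallel (line Q R) (line B D)" "affine_parallel (line R S) (line A C)"
    if "r \<noteq> 1" "homothetic_parallelogram A B C D r P Q R S" for r P Q R S
  proof -
    \<comment> \<open>These are the coefficients of the side vectors; for
      \<open>r \<noteq> 1\<close> they are nonzero, so consecutive vertices span genuine
      lines.\<close>
    from that(1) coords(6,7)
    have nz: "(1 - r) * (b - d) \<noteq> 0" "(1 - r) * (c - a) \<noteq> 0"
      "(1 - r) * (d - b) \<noteq> 0" "(1 - r) * (a - c) \<noteq> 0"
      by auto
    have "P = S + ((1 - r) * (b - d)) *\<^sub>R v" "Q = P + ((1 - r) * (c - a)) *\<^sub>R u"
      "R = Q + ((1 - r) * (d - b)) *\<^sub>R v" "S = R + ((1 - r) * (a - c)) *\<^sub>R u"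
      using that(2) unfolding parallelogram list.map list.inject
      by (simp_all (no_asm_simp) add: homothety_def algebra_simps)
    then have "line S P = line_along S v" "line P Q = line_along P u"
      "line Q R = line_along Q v" "line R S = line_along R u"
      using nz by (metis affine_hull_pair_eq_line_along')+
    then show "affine_parallel (line S P) (line B D)" "affine_parallel (line P Q) (line A C)"
      "affine_parallel (line Q R) (line B D)" "affine_parallel (line R S) (line A C)"
      by (simp_all add: lines affine_parallel_line_along)
  qed
  \<comment> \<open>The diagonals are the coordinate axes, hence both offsets are
    \<open>0\<close>.\<close>
  have "line A C \<inter> line B D = {M}"
    using line_along_Int[OF coords(1), of M 0 0] by (simp add: lines Int_commute)
  then have degenerate: "line A C \<inter> line B D = {P}" "Q = P" "R = P" "S = P"
    if "homothetic_parallelogram A B C D 1 P Q R S" for P Q R S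
    using that by (simp_all add: parallelogram homothety_def)
  \<comment> \<open>Both vertex lists are images of the one of ratio \<open>0\<close> under
    homotheties with centre \<open>M\<close> and nonzero ratios \<open>1 - r\<close> and
    \<open>1 - r'\<close>.\<close>
  have similar: "similar_polygons [P, Q, R, S] [P', Q', R', S']"
    if "r \<noteq> 1" "r' \<noteq> 1" "homothetic_parallelogram A B C D r P Q R S"
      "homothetic_parallelogram A B C D r' P' Q' R' S'" for r r' P Q R S P' Q' R' S'
    using that unfolding parallelogram by (simp only:) (rule similar_polygons_homothety, simp_all)
  have exists: "\<exists>P Q R S. homothetic_parallelogram A B C D r P Q R S" for r
    by (simp add: parallelogram)
  have parallels: "affine_parallel (homothetic_line r A D B) (line B D)"
    "affine_parallel (homothetic_line r B A C) (line A C)"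
    "affine_parallel (homothetic_line r C B D) (line B D)"
    "affine_parallel (homothetic_line r D C A) (line A C)" for r
    by (simp_all add: lines affine_parallel_line_along)
  show ?thesis
    by (intro conjI allI impI; (elim conjE)?;
      (rule exists parallels | erule degenerate | erule (1) sides | erule (3) similar))
qed

end
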